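(* Let $F^+(P_n)\in\mathbb{N}\cup\{*\}$ be the normal foreclosed Sprague-Grundy number of the path $P_n$, defined below. Suppose that for some integers $p>0$ and $q>0$ we have $$F^+(P_{n+p})=F^+(P_n)\quad\text{for every } n \text{ with } q\le n\le 2q+p+2.$$ Then $F^+(P_{n+p})=F^+(P_n)$ for every $n\ge q$.
   Context: For $n\ge 0$, $P_n$ denotes the path on $n$ vertices ($P_0$ is the empty graph). In Node-Kayles, a move on a graph consists in choosing a vertex $v$ and deleting $v$ together with all its neighbours. Hence for $n\ge 4$ the options of $P_n$ are $P_{n-2}$, $P_{n-3}$ and the disjoint unions $P_i\cup P_j$ with $j\ge i\ge 1$, $i+j=n-3$. The sequence $F^+(P_n)$ takes values in $\mathbb{N}\cup\{*\}$, where $*$ means "undefined", and is defined recursively by $F^+(P_0)=F^+(P_1)=F^+(P_2)=F^+(P_3)=*$ and, for $n\ge 4$, $$F^+(P_n)=\mathrm{mex}\big(\{F^+(P_{n-2}),F^+(P_{n-3})\}\cup\{F^+(P_i)\oplus F^+(P_j):\ j\ge i\ge 1,\ i+j=n-3\}\big).$$ Here $\oplus$ is bitwise XOR (Nim-sum) on nonnegative integers, extended by $x\oplus *=*\oplus x=*$ for every $x$. The value $\mathrm{mex}(S)$ is the least nonnegative integer not belonging to $S$; elements equal to $*$ are ignored. Equalities in the statement are equalities in $\mathbb{N}\cup\{*\}$. *)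

theory Defs
  imports Main
begin

text \<open>
  Values in \<open>\<nat> \<union> {*}\<close> are rendered as \<^typ>\<open>nat option\<close>, the undefined value
  \<open>*\<close> being \<open>None\<close>.
\<close>

fun nim_sum :: "nat option \<Rightarrow> nat option \<Rightarrow> nat option" (infixl "\<oplus>" 65) where
  "Some a \<oplus> Some b = Some (Bit_Operations.xor a b)"
| "None \<oplus> y = None"
| "x \<oplus> None = None"

definition mex :: "nat option set \<Rightarrow> nat" where
  "mex S = (LEAST m. Some m \<notin> S)"

text \<open>
  \<open>F_plus n\<close> is the value \<open>F\<^sup>+(P\<^sub>n)\<close> of the path on \<open>n\<close> vertices. The disjoint unions are
  collected as an image of a set of pairs only so that the termination argument sees the bounds
  on \<open>i\<close> and \<open>j\<close>; the set-builder form of the recursion is \<open>F_plus_rec\<close>.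
\<close>

function F_plus :: "nat \<Rightarrow> nat option" where
  "F_plus n =
    (if n < 4 then None
     else Some (mex ({F_plus (n - 2), F_plus (n - 3)} \<union>
       (\<lambda>(i, j). F_plus i \<oplus> F_plus j) ` {(i, j). 1 \<le> i \<and> i \<le> j \<and> i + j = n - 3})))"
  by auto
termination
  by (relation "measure id") auto

declare F_plus.simps [simp del]

lemma F_plus_base: "n \<le> 3 \<Longrightarrow> F_plus n = None"
  by (simp add: F_plus.simps)

lemma F_plus_rec:
  assumes "n \<ge> 4"
  shows "F_plus n =
    Some (mex ({F_plus (n - 2), F_plus (n - 3)} \<union>
      {F_plus i \<oplus> F_plus j | i j. j \<ge> i \<and> i \<ge> 1 \<and> i + j = n - 3}))"
proof -
  have "(\<lambda>(i, j). F_plus i \<oplus> F_plus j) ` {(i, j). 1 \<le> i \<and> i \<le> j \<and> i + j = n - 3}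
      = {F_plus i \<oplus> F_plus j | i j. j \<ge> i \<and> i \<ge> 1 \<and> i + j = n - 3}"
    by (auto simp: image_iff)
  then show ?thesis
    using assms by (subst F_plus.simps) simp
qed

end

theory Submission
  imports Defs
begin

text \<open>
  In a disjoint union of two paths that is an option of \<open>P\<^bsub>n+p\<^esub>\<close> with \<open>n \<ge> 2q + p + 3\<close>, the
  longer path has at least \<open>q + p\<close> vertices, so by induction it can be shortened by \<open>p\<close> without
  changing its value; conversely the longer path in an option of \<open>P\<^sub>n\<close> has at least \<open>q\<close> vertices
  and can be lengthened by \<open>p\<close>. Hence \<open>P\<^bsub>n+p\<^esub>\<close> and \<open>P\<^sub>n\<close> have the same set of option values.
\<close>

lemma nim_sum_commute: "x \<oplus> y = y \<oplus> x"
  by (cases x; cases y) (simp_all add: xor.commute)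

text \<open>Shortening the longer path by \<open>p\<close> can make it the shorter one, so options
  are compared without the order condition; commutativity of \<open>\<oplus>\<close> allows
  this.\<close>

lemma option_values_unordered:
  "{F_plus i \<oplus> F_plus j | i j. j \<ge> i \<and> i \<ge> 1 \<and> i + j = m}
    = {F_plus i \<oplus> F_plus j | i j. i \<ge> 1 \<and> j \<ge> 1 \<and> i + j = m}" (is "?A = ?B")
proof
  show "?A \<subseteq> ?B"
    by fastforce
  show "?B \<subseteq> ?A"
  proof
    fix x assume "x \<in> ?B"
    then obtain i j where ij: "x = F_plus i \<oplus> F_plus j" "i \<ge> 1" "j \<ge> 1" "i + j = m"
      by blast
    show "x \<in> ?A"
    proof (cases "i \<le> j")
      case True
      with ij show ?thesis by blast
    next
      case False
      then have "x = F_plus j \<oplus> F_plus i" "i \<ge> j" "j + i = m"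
        using ij by (simp_all add: nim_sum_commute)
      with ij show ?thesis by blast
    qed
  qed
qed

theorem theorem1:
  fixes p q :: nat
  assumes "p > 0" and "q > 0"
    and "\<And>n. q \<le> n \<Longrightarrow> n \<le> 2 * q + p + 2 \<Longrightarrow> F_plus (n + p) = F_plus n"
  shows "\<forall>n\<ge>q. F_plus (n + p) = F_plus n"
proof (intro allI impI)
  fix n assume "n \<ge> q"
  then show "F_plus (n + p) = F_plus n"
  proof (induction n rule: less_induct)
    case (less n)
    show ?case
    proof (cases "n \<le> 2 * q + p + 2")
      case True
      with less.prems show ?thesis by (rule assms(3))
    next
      case False
      then have n: "n \<ge> 2 * q + p + 3" by simp
      have "F_plus (n + p - 2) = F_plus (n - 2)" "F_plus (n + p - 3) = F_plus (n - 3)"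
        using less.IH[of "n - 2"] less.IH[of "n - 3"] n by simp_all
      moreover have "{F_plus i \<oplus> F_plus j | i j. j \<ge> i \<and> i \<ge> 1 \<and> i + j = n + p - 3}
          \<subseteq> {F_plus i \<oplus> F_plus j | i j. i \<ge> 1 \<and> j \<ge> 1 \<and> i + j = n - 3}"
      proof clarify
        fix i j assume ij: "i \<le> j" "1 \<le> i" "i + j = n + p - 3"
        \<comment> \<open>The larger summand is at least half of
          \<open>n + p - 3 \<ge> 2 * q + 2 * p\<close>; this is what the bound
          \<open>2 * q + p + 2\<close> provides.\<close>
        then have "j \<ge> q + p" "j - p < n" using n by linarith+
        then have "F_plus j = F_plus (j - p)" using less.IH[of "j - p"] by simp
        \<comment> \<open>The shortened path is non-empty, as
          \<open>j - p \<ge> q > 0\<close>.\<close>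
        moreover have "j - p \<ge> 1" "i + (j - p) = n - 3"
          using ij \<open>j \<ge> q + p\<close> \<open>q > 0\<close> by linarith+
        ultimately show "\<exists>i' j'. F_plus i \<oplus> F_plus j = F_plus i' \<oplus> F_plus j' \<and>
            i' \<ge> 1 \<and> j' \<ge> 1 \<and> i' + j' = n - 3"
          using ij by metis
      qed
      moreover have "{F_plus i \<oplus> F_plus j | i j. j \<ge> i \<and> i \<ge> 1 \<and> i + j = n - 3}
          \<subseteq> {F_plus i \<oplus> F_plus j | i j. i \<ge> 1 \<and> j \<ge> 1 \<and> i + j = n + p - 3}"
      proof clarify
        fix i j assume ij: "i \<le> j" "1 \<le> i" "i + j = n - 3"
        then have "j \<ge> q" "j < n" using n by linarith+
        then have "F_plus j = F_plus (j + p)" using less.IH[of j] by simp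
        moreover have "j + p \<ge> 1" "i + (j + p) = n + p - 3"
          using ij n by linarith+
        ultimately show "\<exists>i' j'. F_plus i \<oplus> F_plus j = F_plus i' \<oplus> F_plus j' \<and>
            i' \<ge> 1 \<and> j' \<ge> 1 \<and> i' + j' = n + p - 3"
          using ij by metis
      qed
      ultimately have "{F_plus (n + p - 2), F_plus (n + p - 3)} \<union>
            {F_plus i \<oplus> F_plus j | i j. j \<ge> i \<and> i \<ge> 1 \<and> i + j = n + p - 3}
          = {F_plus (n - 2), F_plus (n - 3)} \<union>
            {F_plus i \<oplus> F_plus j | i j. j \<ge> i \<and> i \<ge> 1 \<and> i + j = n - 3}"
        \<comment> \<open>In unordered form the two inclusions are converse to each other.\<close>
        unfolding option_values_unordered by (intro arg_cong2[where f = union] subset_antisym) simp_all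
      then show ?thesis
        \<comment> \<open>Both indices are at least 4, so the recursion applies to each.\<close>
        using n \<open>q > 0\<close> F_plus_rec[of "n + p"] F_plus_rec[of n] by simp
    qed
  qed
qed

end
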